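(* Let $r\ge 2$ and $k\ge 1$ be fixed integers, and let $F_r$ be the free group of rank $r$. Malnormality is exponentially generic in the word-based distribution; that is, there exists a constant $c>0$ such that, as $n\to\infty$, $$\frac{\left|\{\vec h=(h_1,\dots,h_k)\in R_n^k : \langle h_1,\dots,h_k\rangle \text{ is not a malnormal subgroup of } F_r\}\right|}{|R_n|^k}=O(e^{-cn}).$$
   Context: $F_r=F(A)$ is the free group over an alphabet $A$ with $r$ letters; its elements are represented by reduced words over $A\cup A^{-1}$. $R_n$ denotes the set of reduced words of length at most $n$. In the word-based distribution, $k$ is fixed, a $k$-tuple $\vec h=(h_1,\dots,h_k)$ is chosen uniformly at random in $R_n^k$, and one considers the subgroup it generates. A property is exponentially generic if the proportion of $k$-tuples in $R_n^k$ failing it is $O(e^{-cn})$ for some $c>0$. A subgroup $H$ of $F_r$ is malnormal if $H\cap H^g=1$ for every $g\notin H$, where $H^g=g^{-1}Hg$. *)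

theory Defs
  imports Complex_Main "HOL-Library.Landau_Symbols" "HOL-Algebra.Generated_Groups"
begin

(* The pair (a, True) stands for the letter a, the pair (a, False) for its formal inverse. *)
type_synonym 'a letter = "'a \<times> bool"

definition inv_letter :: "'a letter \<Rightarrow> 'a letter" where
  "inv_letter x = (fst x, \<not> snd x)"

definition reduced :: "'a letter list \<Rightarrow> bool" where
  "reduced w \<longleftrightarrow> (\<forall>i. Suc i < length w \<longrightarrow> w ! Suc i \<noteq> inv_letter (w ! i))"

definition reduced_words :: "'a set \<Rightarrow> 'a letter list set" where
  "reduced_words A = {w. set w \<subseteq> A \<times> UNIV \<and> reduced w}"

definition reduced_words_upto :: "'a set \<Rightarrow> nat \<Rightarrow> 'a letter list set" where
  "reduced_words_upto A n = {w \<in> reduced_words A. length w \<le> n}"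

(* push_letter x w is the reduced form of the word x # w when w is already reduced. *)
fun push_letter :: "'a letter \<Rightarrow> 'a letter list \<Rightarrow> 'a letter list" where
  "push_letter x [] = [x]"
| "push_letter x (y # w) = (if y = inv_letter x then w else x # y # w)"

(* The product of two reduced words is the reduced form of their concatenation. *)
definition free_group :: "'a set \<Rightarrow> 'a letter list monoid" where
  "free_group A =
     \<lparr>carrier = reduced_words A, mult = (\<lambda>u v. foldr push_letter u v), one = []\<rparr>"

definition malnormal :: "('a, 'b) monoid_scheme \<Rightarrow> 'a set \<Rightarrow> bool" where
  "malnormal G H \<longleftrightarrow>
     subgroup H G \<and>
     (\<forall>g \<in> carrier G - H.
        H \<inter> (\<lambda>h. inv\<^bsub>G\<^esub> g \<otimes>\<^bsub>G\<^esub> h \<otimes>\<^bsub>G\<^esub> g) ` H = {\<one>\<^bsub>G\<^esub>})"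

lemma inv_letter_inv_letter [simp]: "inv_letter (inv_letter x) = x"
  by (simp add: inv_letter_def)

lemma reduced_Nil [simp]: "reduced []"
  and reduced_single [simp]: "reduced [x]"
  by (simp_all add: reduced_def)

lemma reduced_Cons_Cons [simp]:
  "reduced (x # y # w) \<longleftrightarrow> y \<noteq> inv_letter x \<and> reduced (y # w)"
  by (auto simp: reduced_def nth_Cons split: nat.splits)

lemma reduced_ConsD: "reduced (x # w) \<Longrightarrow> reduced w"
  by (cases w) auto

lemma reduced_push_letter: "reduced w \<Longrightarrow> reduced (push_letter x w)"
  by (cases w) (auto dest: reduced_ConsD)

lemma set_push_letter: "set (push_letter x w) \<subseteq> insert x (set w)"
  by (cases w) auto

lemma push_letter_inv: "reduced w \<Longrightarrow> push_letter (inv_letter x) (push_letter x w) = w"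
proof (cases w)
  case (Cons y v)
  assume "reduced w"
  with Cons show ?thesis by (cases v) auto
qed simp

lemma reduced_foldr: "reduced v \<Longrightarrow> reduced (foldr push_letter u v)"
  by (induction u) (auto intro: reduced_push_letter)

lemma set_foldr: "set (foldr push_letter u v) \<subseteq> set u \<union> set v"
  using set_push_letter by (induction u) fastforce+

lemma foldr_push_letter:
  assumes "reduced v"
  shows "foldr push_letter (push_letter x u) v = push_letter x (foldr push_letter u v)"
proof (cases u)
  case (Cons y w)
  have "reduced (foldr push_letter w v)"
    using assms by (rule reduced_foldr)
  then show ?thesis
    using Cons push_letter_inv[of "foldr push_letter w v" "inv_letter x"] by auto
qed simp

lemma foldr_assoc:
  assumes "reduced w"
  shows "foldr push_letter (foldr push_letter u v) w = foldr push_letter u (foldr push_letter v w)"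
  by (induction u) (simp_all add: foldr_push_letter assms)

lemma foldr_Nil: "reduced u \<Longrightarrow> foldr push_letter u [] = u"
proof (induction u)
  case (Cons x u)
  then show ?case by (cases u) (auto dest: reduced_ConsD)
qed simp

lemma foldr_inverse:
  "reduced v \<Longrightarrow> foldr push_letter (map inv_letter (rev u)) (foldr push_letter u v) = v"
  by (induction u arbitrary: v) (simp_all add: push_letter_inv reduced_foldr)

lemma group_free_group: "group (free_group A)"
proof (rule groupI)
  fix x y assume "x \<in> carrier (free_group A)" "y \<in> carrier (free_group A)"
  then show "x \<otimes>\<^bsub>free_group A\<^esub> y \<in> carrier (free_group A)"
    using set_foldr[of x y] reduced_foldr[of y x]
    by (auto simp: free_group_def reduced_words_def)
next
  fix x assume x: "x \<in> carrier (free_group A)"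
  let ?y = "foldr push_letter (map inv_letter (rev x)) []"
  have "?y \<in> carrier (free_group A)"
    using x set_foldr[of "map inv_letter (rev x)" "[]"]
    by (fastforce simp: free_group_def reduced_words_def inv_letter_def reduced_foldr)
  moreover have "?y \<otimes>\<^bsub>free_group A\<^esub> x = \<one>\<^bsub>free_group A\<^esub>"
    using x foldr_assoc[of x "map inv_letter (rev x)" "[]"] foldr_inverse[of "[]" x] foldr_Nil[of x]
    by (simp add: free_group_def reduced_words_def)
  ultimately show "\<exists>y \<in> carrier (free_group A). y \<otimes>\<^bsub>free_group A\<^esub> x = \<one>\<^bsub>free_group A\<^esub>"
    by blast
qed (auto simp: free_group_def reduced_words_def foldr_assoc)

end

theory Submission
  imports Defs "HOL-Real_Asymp.Real_Asymp"
begin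

text \<open>
  Let \<open>L\<close> be a small fixed fraction of \<open>n\<close>. A random tuple of reduced words has, with
  exponentially small exceptional probability, long entries in which no block of length \<open>L\<close> is
  read twice, neither in two entries, nor at two places of one entry, nor once forwards and once
  as an inverse (\<open>no_repeats\<close>). Malnormality follows deterministically from this.

  The deterministic part (\<open>malnormal_generate\<close>). Call \<open>Y\<close> the set of generators and their
  inverses, and \<open>H\<close> the subgroup. As two different elements of \<open>Y\<close> have no common prefix of
  length \<open>L\<close>, a product of generators without trivial cancellation loses fewer than \<open>L\<close>
  letters at either end of each factor. So whenever a long block is read along a reduced word of
  \<open>H\<close>, half of it is read inside a single generator \<open>y\<close>, and the prefix of the word before
  that half is an element of \<open>H\<close> times a prefix of \<open>y\<close> (\<open>chain_product_blocks\<close>); in the language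
  of coset graphs, the block determines an edge path inside one petal. If \<open>h \<noteq> 1\<close> and \<open>g\<inverse>hg\<close>
  are both in \<open>H\<close>, then so are \<open>h\<^sup>N\<close> and \<open>g\<inverse>h\<^sup>Ng\<close>. The length of \<open>h\<^sup>N\<close> is unbounded
  (\<open>powers_unbounded\<close>), so for large \<open>N\<close> the two reduced words share a long block, whose
  preceding prefixes differ by left multiplication with \<open>g\<close>
  (\<open>conjugate_common_block\<close>). Both words read a sub-block of length \<open>L\<close> inside generators,
  by uniqueness at the same place of the same generator, and comparing prefixes gives \<open>g \<in> H\<close>
  (\<open>common_block_imp_in_H\<close>).

  The probabilistic part (\<open>card_not_malnormal\<close>). Put \<open>q = 2r - 1\<close>. There are between
  \<open>q\<^sup>n\<close> and \<open>3q\<^sup>n\<close> reduced words of length at most \<open>n\<close>, so a condition that forces \<open>l\<close>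
  consecutive letters, each from the letters before it, has probability of order at most
  \<open>q\<close> to the power \<open>-l\<close> (\<open>card_predicted\<close>). A repeated block of length \<open>2l\<close> is such a
  condition on one entry, the other entries being given: its later occurrence, or the second half of
  it if the two occurrences are mutually inverse, can be predicted from the data before it. The
  positions of the two occurrences contribute only a factor polynomial in \<open>n\<close>.
\<close>

section \<open>Words and their products\<close>

abbreviation word_mult :: "'a letter list \<Rightarrow> 'a letter list \<Rightarrow> 'a letter list" (infixl "\<cdot>" 70) where
  "u \<cdot> v \<equiv> foldr push_letter u v"

definition word_inv :: "'a letter list \<Rightarrow> 'a letter list" where
  "word_inv w = map inv_letter (rev w)"

lemma inv_letter_neq [simp]: "inv_letter x \<noteq> x" "x \<noteq> inv_letter x"
  by (auto simp: inv_letter_def prod_eq_iff)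

lemma inv_letter_eq_iff [simp]: "inv_letter x = inv_letter y \<longleftrightarrow> x = y"
  by (auto simp: inv_letter_def prod_eq_iff)

lemma word_inv_Nil [simp]: "word_inv [] = []"
  and word_inv_Cons: "word_inv (x # w) = word_inv w @ [inv_letter x]"
  and word_inv_append [simp]: "word_inv (u @ v) = word_inv v @ word_inv u"
  and length_word_inv [simp]: "length (word_inv w) = length w"
  by (simp_all add: word_inv_def)

lemma word_inv_word_inv [simp]: "word_inv (word_inv w) = w"
  by (simp add: word_inv_def rev_map o_def)

lemma word_inv_eq_iff [simp]: "word_inv u = word_inv v \<longleftrightarrow> u = v"
  by (metis word_inv_word_inv)

lemma nth_word_inv: "i < length w \<Longrightarrow> word_inv w ! i = inv_letter (w ! (length w - 1 - i))"
  by (simp add: word_inv_def rev_nth)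

lemma reduced_append:
  "reduced (u @ v) \<longleftrightarrow>
     reduced u \<and> reduced v \<and> (u \<noteq> [] \<longrightarrow> v \<noteq> [] \<longrightarrow> hd v \<noteq> inv_letter (last u))"
proof (induction u)
  case (Cons x u)
  then show ?case by (cases u; cases v) auto
qed simp

lemma reduced_word_inv [simp]: "reduced (word_inv w) \<longleftrightarrow> reduced w"
proof -
  have "reduced w \<Longrightarrow> reduced (word_inv w)" for w :: "'a letter list"
  proof (induction w)
    case (Cons x w)
    then show ?case
      by (cases w) (auto simp: word_inv_Cons reduced_append)
  qed simp
  then show ?thesis by (metis word_inv_word_inv)
qed

lemma word_inv_in_reduced_words [simp]: "word_inv w \<in> reduced_words A \<longleftrightarrow> w \<in> reduced_words A"
proof -
  have "set (word_inv w) \<subseteq> A \<times> UNIV \<longleftrightarrow> set w \<subseteq> A \<times> UNIV"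
    by (force simp: word_inv_def inv_letter_def)
  then show ?thesis by (simp add: reduced_words_def)
qed

lemma word_mult_append: "reduced (u @ v) \<Longrightarrow> u \<cdot> v = u @ v"
proof (induction u)
  case (Cons x u)
  then show ?case by (cases "u @ v") (auto dest: reduced_ConsD)
qed simp

lemma word_inv_mult: "reduced v \<Longrightarrow> word_inv u \<cdot> (u \<cdot> v) = v"
  unfolding word_inv_def by (rule foldr_inverse)

text \<open>By induction from the last letter of \<open>u\<close>: either it cancels against the first letter of \<open>v\<close>, or
  the concatenation is reduced already.\<close>
lemma word_mult_cancel:
  assumes "reduced u" and "reduced v"
  obtains u' c v' where "u = u' @ c" and "v = word_inv c @ v'" and "u \<cdot> v = u' @ v'"
  using assms
proof (induction u arbitrary: v thesis rule: rev_induct)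
  case Nil
  then show ?case by simp
next
  case (snoc x u)
  show ?case
  proof (cases "v \<noteq> [] \<and> hd v = inv_letter x")
    case True
    then obtain w where v: "v = inv_letter x # w" by (cases v) auto
    have "reduced u" "reduced w"
      using snoc.prems v by (auto simp: reduced_append dest: reduced_ConsD)
    then obtain u' c v' where *: "u = u' @ c" "w = word_inv c @ v'" "u \<cdot> w = u' @ v'"
      using snoc.IH by blast
    show ?thesis
      by (rule snoc.prems(1)[of u' "c @ [x]" v']) (use * v in \<open>auto simp: word_inv_Cons\<close>)
  next
    case False
    then have "reduced ((u @ [x]) @ v)"
      using snoc.prems by (subst reduced_append) auto
    then show ?thesis
      by (intro snoc.prems(1)[of "u @ [x]" "[]" v]) (simp_all only: word_mult_append, auto)
  qed
qed

lemma length_word_mult_ge: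
  assumes "reduced u" and "reduced v"
  shows "length v \<le> length (u \<cdot> v) + length u" and "length u \<le> length (u \<cdot> v) + length v"
proof -
  obtain u' c v' where "u = u' @ c" "v = word_inv c @ v'" "u \<cdot> v = u' @ v'"
    using word_mult_cancel[OF assms] .
  then show "length v \<le> length (u \<cdot> v) + length u" "length u \<le> length (u \<cdot> v) + length v"
    by auto
qed

lemma carrier_free_group [simp]: "carrier (free_group A) = reduced_words A"
  and mult_free_group [simp]: "u \<otimes>\<^bsub>free_group A\<^esub> v = u \<cdot> v"
  and one_free_group [simp]: "\<one>\<^bsub>free_group A\<^esub> = []"
  by (simp_all add: free_group_def)

lemma inv_free_group [simp]:
  assumes "w \<in> reduced_words A"
  shows "inv\<^bsub>free_group A\<^esub> w = word_inv w"
proof -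
  interpret group "free_group A" by (rule group_free_group)
  have "word_inv w \<cdot> w = []"
    using word_inv_mult[of "[]" w] assms by (simp add: foldr_Nil reduced_words_def)
  then show ?thesis
    using inv_equality[of "word_inv w" w] assms by simp
qed

lemma reduced_words_append_iff:
  "u @ v \<in> reduced_words A \<longleftrightarrow> u \<in> reduced_words A \<and> v \<in> reduced_words A \<and> reduced (u @ v)"
  by (auto simp: reduced_words_def reduced_append)

lemma (in group) conjugate_pow:
  assumes "x \<in> carrier G" and "t \<in> carrier G"
  shows "(x \<otimes> t \<otimes> inv x) [^] (N::nat) = x \<otimes> t [^] N \<otimes> inv x"
proof (induction N)
  case (Suc N)
  have "inv x \<otimes> (x \<otimes> y) = y" if "y \<in> carrier G" for y
    using assms that by (simp add: m_assoc[symmetric])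
  with Suc assms show ?case by (simp add: m_assoc)
qed (use assms in simp)

text \<open>If the last letter of \<open>z\<close> does not cancel against the first, the literal powers of \<open>z\<close> are
  reduced and their lengths grow linearly. Otherwise \<open>z\<close> is a conjugate, by one letter, of a
  shorter nonempty word; conjugating a power by a letter costs at most two letters, so induction on
  the length applies.\<close>
lemma powers_unbounded:
  assumes "z \<in> reduced_words A" and "z \<noteq> []"
  shows "\<exists>N. M \<le> length (z [^]\<^bsub>free_group A\<^esub> (N::nat))"
  using assms
proof (induction "length z" arbitrary: z M rule: less_induct)
  case less
  interpret group "free_group A" by (rule group_free_group)
  have z: "reduced z" using less.prems by (simp add: reduced_words_def)
  show ?case
  proof (cases "hd z = inv_letter (last z)")
    case False
    have pow: "z [^]\<^bsub>free_group A\<^esub> (N::nat) = concat (replicate N z) \<and>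
               reduced (concat (replicate N z))" for N
    proof (induction N)
      case (Suc N)
      have red: "reduced (z @ concat (replicate N z))"
        using Suc False z less.prems by (cases N) (auto simp: reduced_append)
      have "z [^]\<^bsub>free_group A\<^esub> Suc N = z \<cdot> z [^]\<^bsub>free_group A\<^esub> N"
        using nat_pow_Suc2[of z N] less.prems by simp
      then show ?case using Suc red by (simp add: word_mult_append)
    qed simp
    have "M \<le> length (concat (replicate M z))"
      using less.prems by (cases z) (auto simp: length_concat sum_list_replicate)
    then show ?thesis using pow by metis
  next
    case True
    define x where "x = hd z"
    obtain t where t: "z = x # t @ [inv_letter x]"
    proof (cases z)
      case (Cons y w)
      with True have "w \<noteq> []" by auto
      then show ?thesis
        using that[of "butlast w"] Cons True by (auto simp: x_def append_butlast_last_id)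
    qed (use less.prems in simp)
    have t0: "t \<noteq> []" using z t by auto
    have xA: "[x] \<in> reduced_words A" and tA: "t \<in> reduced_words A"
      using less.prems z t reduced_append[of t "[inv_letter x]"]
      by (auto simp: reduced_words_def dest: reduced_ConsD)
    have x': "word_inv [x] = [inv_letter x]" by (simp add: word_inv_def)
    have zc: "z = [x] \<cdot> t \<cdot> word_inv [x]"
    proof -
      have "reduced (([x] @ t) @ [inv_letter x])"
        using z t by simp
      moreover from this have "reduced ([x] @ t)"
        using reduced_append by blast
      ultimately show ?thesis using t x' word_mult_append by (metis append_Cons append_Nil)
    qed
    have conj: "z [^]\<^bsub>free_group A\<^esub> N = [x] \<cdot> t [^]\<^bsub>free_group A\<^esub> N \<cdot> word_inv [x]" for N :: nat
      using conjugate_pow[of "[x]" t N] xA tA zc by simp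
    obtain N :: nat where N: "M + 2 \<le> length (t [^]\<^bsub>free_group A\<^esub> N)"
      using less.hyps[of t "M + 2"] t tA t0 by auto
    have p: "reduced (t [^]\<^bsub>free_group A\<^esub> N)"
      using nat_pow_closed[of t N] tA by (simp add: reduced_words_def)
    have "length (t [^]\<^bsub>free_group A\<^esub> N) \<le> length ([x] \<cdot> t [^]\<^bsub>free_group A\<^esub> N) + 1"
      using length_word_mult_ge(1)[of "[x]"] p by simp
    also have "length ([x] \<cdot> t [^]\<^bsub>free_group A\<^esub> N) \<le> length (z [^]\<^bsub>free_group A\<^esub> N) + 1"
      unfolding conj
      using length_word_mult_ge(2)[of "[x] \<cdot> t [^]\<^bsub>free_group A\<^esub> N" "word_inv [x]"] reduced_foldr[OF p, of "[x]"]
      by (simp add: x' del: foldr.simps)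
    finally show ?thesis using N by (intro exI[of _ N]) simp
  qed
qed

section \<open>Non-repeating generators generate malnormal subgroups\<close>

text \<open>Applied to a set closed under inverses, this also controls inverse blocks: if \<open>C\<close> and
  \<open>word_inv C\<close> are read in two words of the set, then these are inverse to each other and the two
  places correspond.\<close>
definition no_repeats :: "nat \<Rightarrow> 'a letter list set \<Rightarrow> bool" where
  "no_repeats L Y \<longleftrightarrow>
     (\<forall>p C s p' s'. p @ C @ s \<in> Y \<longrightarrow> p' @ C @ s' \<in> Y \<longrightarrow> length C = L \<longrightarrow> p = p' \<and> s = s')"

lemma no_repeatsD:
  "no_repeats L Y \<Longrightarrow> p @ C @ s \<in> Y \<Longrightarrow> p' @ C @ s' \<in> Y \<Longrightarrow> length C = L \<Longrightarrow> p = p' \<and> s = s'"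
  unfolding no_repeats_def by blast

text \<open>Products of elements of \<open>Y\<close> in which no factor is inverse to the next one. The first factor \<open>y\<close>
  is recorded because the cancellation in a left multiplication by a further generator takes place
  against it.\<close>
inductive chain_product :: "'a letter list set \<Rightarrow> 'a letter list \<Rightarrow> 'a letter list \<Rightarrow> bool"
  for Y where
  single: "y \<in> Y \<Longrightarrow> chain_product Y y y"
| step: "chain_product Y y z \<Longrightarrow> x \<in> Y \<Longrightarrow> y \<noteq> word_inv x \<Longrightarrow> chain_product Y x (x \<cdot> z)"

text \<open>In the coset graph of \<open>H\<close> the elements of \<open>Y\<close> label closed paths at the base vertex. The path
  labelled \<open>C\<close> that starts at the coset of \<open>P\<close> is a stretch of one of these closed paths.\<close>
definition read_inside :: "'a letter list set \<Rightarrow> 'a letter list set \<Rightarrow> 'a letter list \<Rightarrow> 'a letter list \<Rightarrow> bool"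
  where "read_inside H Y P C \<longleftrightarrow> (\<exists>a\<in>H. \<exists>p s. p @ C @ s \<in> Y \<and> P = a \<cdot> p)"

lemma read_insideI: "a \<in> H \<Longrightarrow> p @ C @ s \<in> Y \<Longrightarrow> read_inside H Y (a \<cdot> p) C"
  unfolding read_inside_def by blast

lemma read_inside_mult:
  assumes "read_inside H Y P C" and "x \<in> H" and "subgroup H (free_group A)"
    and "Y \<subseteq> reduced_words A"
  shows "read_inside H Y (x \<cdot> P) C"
proof -
  obtain a p s where *: "a \<in> H" "p @ C @ s \<in> Y" "P = a \<cdot> p"
    using assms(1) by (auto simp: read_inside_def)
  have "p \<in> reduced_words A"
    using *(2) assms(4) by (auto simp: reduced_words_append_iff)
  then have "x \<cdot> P = (x \<cdot> a) \<cdot> p"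
    using *(3) by (simp add: foldr_assoc reduced_words_def)
  moreover have "x \<cdot> a \<in> H"
    using subgroup.m_closed[OF assms(3) assms(2) *(1)] by simp
  ultimately show ?thesis using *(2) by (auto simp: read_inside_def)
qed

lemma take_append_drop_append [simp]: "take m u @ drop m u @ v = u @ v"
  by (simp flip: append_assoc)

locale small_overlap =
  fixes A :: "'a set" and Y :: "'a letter list set" and L :: nat
  assumes Y_sub: "Y \<subseteq> reduced_words A"
    and Y_inv: "y \<in> Y \<Longrightarrow> word_inv y \<in> Y"
    and unique: "no_repeats L Y"
    and long: "y \<in> Y \<Longrightarrow> 4 * L \<le> length y"
    and L_pos: "0 < L"
begin

abbreviation "H \<equiv> generate (free_group A) Y"

lemma H_subgroup: "subgroup H (free_group A)"
  using group.generate_is_subgroup[OF group_free_group] Y_sub by simp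

lemma H_sub: "H \<subseteq> reduced_words A"
  using subgroup.subset[OF H_subgroup] by simp

lemma Nil_H: "[] \<in> H"
  using generate.one[of "free_group A" Y] by simp

lemma H_mult: "a \<in> H \<Longrightarrow> b \<in> H \<Longrightarrow> a \<cdot> b \<in> H"
  using subgroup.m_closed[OF H_subgroup] by simp

lemma Y_H: "y \<in> Y \<Longrightarrow> y \<in> H"
  by (rule generate.incl)

lemma chain_product_in_H: "chain_product Y y z \<Longrightarrow> z \<in> H"
  by (induction rule: chain_product.induct) (auto intro: H_mult Y_H)

lemma chain_product_head: "chain_product Y y z \<Longrightarrow> y \<in> Y"
  by (induction rule: chain_product.induct) auto

text \<open>The elements that are trivial or chain products are closed under left multiplication by \<open>Y\<close>: a
  generator inverse to the head of the chain removes that head, any other one prolongs the chain.\<close>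
lemma H_chain_product:
  assumes "z \<in> H" and "z \<noteq> []"
  shows "\<exists>y. chain_product Y y z"
proof -
  interpret group "free_group A" by (rule group_free_group)
  define N where "N = insert [] {z. \<exists>y. chain_product Y y z}"
  have N_sub: "N \<subseteq> reduced_words A"
    using chain_product_in_H H_sub one_closed by (auto simp: N_def)
  have left: "x \<cdot> z \<in> N" if x: "x \<in> Y" and "z \<in> N" for x z
  proof (cases "z = []")
    case True
    then show ?thesis
      using x Y_sub foldr_Nil[of x] chain_product.single[OF x] by (auto simp: N_def reduced_words_def)
  next
    case False
    then obtain y where y: "chain_product Y y z" using \<open>z \<in> N\<close> by (auto simp: N_def)
    show ?thesis
    proof (cases "y = word_inv x")
      case yx: True
      from y show ?thesis
      proof cases
        case single
        have "x \<cdot> word_inv x = []"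
          using r_inv[of x] x Y_sub by auto
        then show ?thesis using single yx by (simp add: N_def)
      next
        case (step y' z')
        have "x \<cdot> (word_inv x \<cdot> z') = z'"
          using word_inv_mult[of z' "word_inv x"] chain_product_in_H[OF step(2)] H_sub
          by (auto simp: reduced_words_def)
        then show ?thesis using step yx by (auto simp: N_def)
      qed
    qed (use chain_product.step[OF y x] in \<open>auto simp: N_def\<close>)
  qed
  have "z \<cdot> w \<in> N" if "w \<in> N" for w
    using assms(1) that
  proof (induction arbitrary: w rule: generate.induct)
    case one
    then show ?case by simp
  next
    case (incl y)
    then show ?case by (rule left)
  next
    case (inv y)
    moreover from this have "inv\<^bsub>free_group A\<^esub> y = word_inv y" using Y_sub by auto
    ultimately show ?case using left[OF Y_inv] by simp
  next
    case (eng a b)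
    then show ?case using N_sub by (auto simp: foldr_assoc reduced_words_def)
  qed
  then have "z \<cdot> [] \<in> N" by (simp add: N_def)
  moreover have "z \<cdot> [] = z"
    using assms(1) H_sub foldr_Nil[of z] by (auto simp: reduced_words_def)
  ultimately show ?thesis using assms(2) by (simp add: N_def)
qed

text \<open>Cancelling \<open>L\<close> or more letters would exhibit a common prefix of length \<open>L\<close> of the generators
  \<open>y\<close> and \<open>word_inv x\<close>. The hypothesis on \<open>z\<close> says that the part of \<open>y\<close> without its last
  \<open>L\<close> letters is still visible at the front of \<open>z\<close>, so that cancellation against \<open>z\<close> takes
  place inside \<open>y\<close>.\<close>
lemma chain_cancellation:
  assumes "chain_product Y y z" and "z = take (length y - L) y @ R" and "x \<in> Y" and "y \<noteq> word_inv x"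
  obtains u c v where "x = u @ c" and "z = word_inv c @ v" and "x \<cdot> z = u @ v" and "length c < L"
proof -
  have yY: "y \<in> Y" using assms(1) by (rule chain_product_head)
  have "reduced x" "reduced z"
    using chain_product_in_H[OF assms(1)] H_sub Y_sub assms(3) by (auto simp: reduced_words_def)
  then obtain u c v where *: "x = u @ c" "z = word_inv c @ v" "x \<cdot> z = u @ v"
    using word_mult_cancel by blast
  have "length c < L"
  proof (rule ccontr)
    assume "\<not> length c < L"
    define C where "C = take L (word_inv c)"
    have lenC: "length C = L" using \<open>\<not> length c < L\<close> by (simp add: C_def)
    have "C = take L z" using * lenC by (simp add: C_def)
    also have "\<dots> = take L y" using assms(2) long[OF yY] by simp
    finally have "y = [] @ C @ drop L y" by simp
    moreover have "word_inv x = [] @ C @ (drop L (word_inv c) @ word_inv u)"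
      using * by (simp add: C_def flip: append_assoc)
    ultimately show False
      using no_repeatsD[OF unique, of "[]" C "drop L y" "[]" "drop L (word_inv c) @ word_inv u"]
        yY Y_inv[OF assms(3)] assms(4) lenC by simp
  qed
  with * that show thesis by blast
qed

text \<open>Multiplying \<open>z = word_inv c @ v\<close> from the left by \<open>x = u @ c\<close> gives \<open>u @ v\<close>. A block of
  \<open>u @ v\<close> lies inside \<open>v\<close>, and then the induction hypothesis applies, or has its first half
  inside \<open>u\<close>, which is a prefix of the generator \<open>x\<close>, or straddles the border with at least half
  of it in \<open>v\<close>. In the last case \<open>v\<close> begins with what remains of \<open>y\<close>: fewer than \<open>L\<close>
  letters are lost at the front and at most \<open>L\<close> at the back, so at least \<open>2 * L\<close> of the
  \<open>4 * L\<close> letters of \<open>y\<close> survive, enough for half a block. The first conjunct keeps the head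
  of the chain visible for the next multiplication.\<close>
lemma chain_product_blocks:
  assumes "chain_product Y y z" and "m \<le> 2 * L"
  shows "(\<exists>R. z = take (length y - L) y @ R) \<and>
    (\<forall>P B S. z = P @ B @ S \<longrightarrow> length B = 2 * m \<longrightarrow>
       (\<exists>B1 C B2. B = B1 @ C @ B2 \<and> length C = m \<and> read_inside H Y (P @ B1) C))"
  using assms(1)
proof induction
  case (single y)
  have "read_inside H Y P (take m B)" if "y = P @ B @ S" for P B S
  proof -
    have "P @ take m B @ (drop m B @ S) \<in> Y"
      using single that by simp
    then show ?thesis using read_insideI[OF Nil_H, of P "take m B" "drop m B @ S" Y] by simp
  qed
  then have "\<exists>B1 C B2. B = B1 @ C @ B2 \<and> length C = m \<and> read_inside H Y (P @ B1) C"
    if "y = P @ B @ S" "length B = 2 * m" for P B S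
    using that by (intro exI[of _ "[]"] exI[of _ "take m B"] exI[of _ "drop m B"]) auto
  moreover have "y = take (length y - L) y @ drop (length y - L) y" by simp
  ultimately show ?case by blast
next
  case (step y z x)
  have yY: "y \<in> Y" using step.hyps(1) by (rule chain_product_head)
  obtain R where R: "z = take (length y - L) y @ R" using step.IH by blast
  obtain u c v where *: "x = u @ c" "z = word_inv c @ v" "x \<cdot> z = u @ v" "length c < L"
    using chain_cancellation[OF step.hyps(1) R step.hyps(2,3)] .
  have red: "reduced (u @ v)"
    using chain_product_in_H[OF chain_product.step[OF step.hyps(1-3)]] H_sub *(3)
    by (auto simp: reduced_words_def)
  have red_z: "reduced z"
    using chain_product_in_H[OF step.hyps(1)] H_sub by (auto simp: reduced_words_def)
  \<comment> \<open>Left multiplication by \<open>x\<close> turns prefixes of \<open>z\<close> beyond the cancelled part into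
    prefixes of \<open>x \<cdot> z\<close>.\<close>
  have shift: "x \<cdot> (word_inv c @ w) = u @ w" if "v = w @ w'" for w w'
  proof -
    have r: "reduced (word_inv c @ w)" "reduced (u @ w)"
      using red red_z *(2) that reduced_append[of "word_inv c @ w" w'] reduced_append[of "u @ w" w']
      by simp_all
    then have "word_inv c @ w = word_inv c \<cdot> w" by (simp add: word_mult_append)
    moreover have "x = u \<cdot> c"
      using *(1) step.hyps(2) Y_sub by (auto simp: word_mult_append reduced_words_def)
    moreover have rw: "reduced w" using r reduced_append by blast
    ultimately have "x \<cdot> (word_inv c @ w) = u \<cdot> (c \<cdot> (word_inv c \<cdot> w))"
      by (simp add: foldr_assoc reduced_foldr)
    also have "c \<cdot> (word_inv c \<cdot> w) = w"
      using word_inv_mult[OF rw, of "word_inv c"] by simp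
    finally show ?thesis using r by (simp add: word_mult_append)
  qed
  have "\<exists>B1 C B2. B = B1 @ C @ B2 \<and> length C = m \<and> read_inside H Y (P @ B1) C"
    if PBS: "u @ v = P @ B @ S" and lenB: "length B = 2 * m" for P B S
  proof -
    consider "length u \<le> length P" | "length P + m \<le> length u"
      | "length P < length u" "length u < length P + m" by linarith
    then show ?thesis
    proof cases
      case 1
      then obtain P2 where P2: "P = u @ P2" "v = P2 @ B @ S"
        using PBS by (auto simp: append_eq_append_conv2)
      then have "z = (word_inv c @ P2) @ B @ S" using *(2) by simp
      then obtain B1 C B2 where B: "B = B1 @ C @ B2" "length C = m"
          "read_inside H Y ((word_inv c @ P2) @ B1) C"
        using step.IH lenB by blast
      have "x \<cdot> ((word_inv c @ P2) @ B1) = P @ B1"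
        using shift[of "P2 @ B1" "C @ B2 @ S"] P2 B(1) by simp
      then have "read_inside H Y (P @ B1) C"
        using read_inside_mult[OF B(3) Y_H[OF step.hyps(2)] H_subgroup Y_sub] by simp
      then show ?thesis using B by blast
    next
      case 2
      have "P @ take m B = take (length P + m) (P @ B @ S)" using lenB by simp
      also have "\<dots> = take (length P + m) u" using 2 by (simp flip: PBS)
      finally have "(P @ take m B) @ drop (length P + m) u @ c = x"
        using *(1) by (simp del: append_assoc)
      then have "P @ take m B @ (drop (length P + m) u @ c) \<in> Y"
        using step.hyps(2) by simp
      then have "read_inside H Y P (take m B)" using read_insideI[OF Nil_H] by simp
      then show ?thesis
        using lenB by (intro exI[of _ "[]"] exI[of _ "take m B"] exI[of _ "drop m B"]) auto
    next
      case 3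
      define B1 where "B1 = drop (length P) u"
      have "P = take (length P) (P @ B @ S)" by simp
      also have "\<dots> = take (length P) u" using 3 by (simp flip: PBS)
      finally have u: "u = P @ B1" by (metis B1_def append_take_drop_id)
      then have lenB1: "length B1 < m" using 3 by simp
      have "B1 @ v = B @ S" using PBS u by simp
      then obtain B' where B': "B = B1 @ B'" "v = B' @ S"
        using lenB1 lenB by (auto simp: append_eq_append_conv2)
      define C where "C = take m B'"
      have lenC: "length C = m" using lenB1 lenB B' by (simp add: C_def)
      have B: "B = B1 @ C @ drop m B'" using B' by (simp add: C_def)
      have "word_inv c @ C = take (length c + m) z"
        using *(2) B' lenC by (simp add: C_def)
      also have "\<dots> = take (length c + m) y"
      proof -
        have "length c + m \<le> length y - L" using *(4) long[OF yY] assms(2) by linarith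
        then have "take (length c + m) (take (length y - L) y @ R) = take (length c + m) y"
          by (simp add: min_absorb1)
        then show ?thesis using R by simp
      qed
      finally have "(word_inv c @ C) @ drop (length c + m) y = y" by (simp del: append_assoc)
      then have "word_inv c @ C @ drop (length c + m) y \<in> Y" using yY by simp
      moreover have "P @ B1 = x \<cdot> word_inv c"
        using shift[of "[]" v] u by simp
      ultimately have "read_inside H Y (P @ B1) C"
        using Y_H[OF step.hyps(2)] unfolding read_inside_def by blast
      then show ?thesis using B lenC by blast
    qed
  qed
  moreover have "x \<cdot> z = take (length x - L) x @ (drop (length x - L) u @ v)"
    using *(1,3,4) by (simp flip: append_assoc)
  ultimately show ?case unfolding *(3) by blast
qed

lemma H_blocks:
  assumes "P @ B @ S \<in> H" and "length B = 2 * m" and "m \<le> 2 * L" and "0 < m"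
  obtains B1 C B2 where "B = B1 @ C @ B2" and "length C = m" and "read_inside H Y (P @ B1) C"
proof -
  have "P @ B @ S \<noteq> []" using assms(2,4) by auto
  then obtain y where "chain_product Y y (P @ B @ S)"
    using H_chain_product assms(1) by blast
  then show thesis
    using chain_product_blocks[OF _ assms(3)] assms(2) that by blast
qed

text \<open>Halving the common block twice, first along one word and then along the other, yields one block
  \<open>D\<close> of length \<open>L\<close> that both words read inside a generator. The generators and positions agree
  by uniqueness, so the prefixes up to \<open>D\<close> are \<open>a \<cdot> q\<close> and \<open>b \<cdot> q\<close> with the same \<open>q\<close> and
  with \<open>a, b \<in> H\<close>, and \<open>g = a \<cdot> word_inv b\<close>.\<close>
lemma common_block_imp_in_H:
  assumes "P @ B @ S \<in> H" and "P' @ B @ S' \<in> H" and "length B = 4 * L"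
    and g: "g \<in> reduced_words A" and P: "P = g \<cdot> P'"
  shows "g \<in> H"
proof -
  interpret group "free_group A" by (rule group_free_group)
  obtain B1 C B2 where B: "B = B1 @ C @ B2" "length C = 2 * L" "read_inside H Y (P @ B1) C"
    using H_blocks[OF assms(1), of "2 * L"] assms(3) L_pos by auto
  obtain D1 D D2 where C: "C = D1 @ D @ D2" "length D = L" "read_inside H Y ((P' @ B1) @ D1) D"
    using H_blocks[of "P' @ B1" C "B2 @ S'" L] assms(2) B(1,2) L_pos by auto
  obtain a p s where a: "a \<in> H" "p @ C @ s \<in> Y" "P @ B1 = a \<cdot> p"
    using B(3) by (auto simp: read_inside_def)
  obtain b q t where b: "b \<in> H" "q @ D @ t \<in> Y" "(P' @ B1) @ D1 = b \<cdot> q"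
    using C(3) by (auto simp: read_inside_def)
  have "(p @ D1) @ D @ (D2 @ s) \<in> Y" using a(2) C(1) by simp
  then have q: "q = p @ D1" using no_repeatsD[OF unique b(2) _ C(2)] by blast
  have qA: "p @ D1 \<in> reduced_words A" "p \<in> reduced_words A" "D1 \<in> reduced_words A"
    using b(2) Y_sub reduced_words_append_iff q by blast+
  have PA: "P @ B1 @ D1 \<in> reduced_words A" "P' @ B1 @ D1 \<in> reduced_words A"
    using assms(1,2) H_sub B(1) C(1) reduced_words_append_iff[of "P @ B1 @ D1" "D @ D2 @ B2 @ S"]
      reduced_words_append_iff[of "P' @ B1 @ D1" "D @ D2 @ B2 @ S'"] by auto
  then have BD: "reduced (B1 @ D1)" by (simp add: reduced_words_append_iff)
  have "P \<cdot> (B1 @ D1) = g \<cdot> (P' \<cdot> (B1 @ D1))"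
    using P BD by (simp add: foldr_assoc del: foldr_append)
  then have 1: "P @ B1 @ D1 = g \<cdot> (P' @ B1 @ D1)"
    using PA by (simp add: word_mult_append reduced_words_def del: foldr_append)
  have "P @ B1 @ D1 = (P @ B1) \<cdot> D1"
    using PA(1) word_mult_append[of "P @ B1" D1] by (simp add: reduced_words_def del: foldr_append)
  also have "\<dots> = a \<cdot> (p \<cdot> D1)"
    using a(3) qA by (simp add: foldr_assoc reduced_words_def del: foldr_append)
  also have "\<dots> = a \<cdot> q"
    using q qA by (simp add: word_mult_append reduced_words_def del: foldr_append)
  finally have eq: "a \<cdot> q = g \<cdot> (b \<cdot> q)" using 1 b(3) by simp
  have ab: "a \<in> reduced_words A" "b \<in> reduced_words A" using a b H_sub by auto
  have "a = g \<cdot> b"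
    using eq right_cancel[of q a "g \<cdot> b"] m_closed[of g b] qA q ab g
    by (simp add: foldr_assoc reduced_words_def del: foldr_append)
  then have "g = a \<cdot> word_inv b"
    using inv_solve_right[of g a b] ab g by simp
  moreover have "word_inv b \<in> H"
    using subgroup.m_inv_closed[OF H_subgroup b(1)] ab by simp
  ultimately show "g \<in> H" using H_mult a(1) by simp
qed

text \<open>Conjugation by \<open>g\<close> alters at most \<open>length g\<close> letters at either end of \<open>w\<close>.\<close>
lemma conjugate_common_block:
  assumes "w \<in> reduced_words A" and "g \<in> reduced_words A" and "2 * length g + M \<le> length w"
  obtains P B S P' S' where "w = P @ B @ S" and "word_inv g \<cdot> w \<cdot> g = P' @ B @ S'"
    and "length B = M" and "P = g \<cdot> P'"
proof -
  have red: "reduced w" "reduced g" "reduced (word_inv g)"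
    using assms by (auto simp: reduced_words_def)
  obtain P' c W where 1: "word_inv g = P' @ c" "w = word_inv c @ W" "word_inv g \<cdot> w = P' @ W"
    using word_mult_cancel[OF red(3,1)] .
  have red1: "reduced (P' @ W)" using reduced_foldr[OF red(1), of "word_inv g"] 1(3) by simp
  obtain X d S' where 2: "P' @ W = X @ d" "g = word_inv d @ S'" "(P' @ W) \<cdot> g = X @ S'"
    using word_mult_cancel[OF red1 red(2)] .
  have lens: "length c \<le> length g" "length d \<le> length g"
    using arg_cong[OF 1(1), of length] arg_cong[OF 2(2), of length] by auto
  then have lenW: "length d + M \<le> length W" using assms(3) 1(2) by simp
  then obtain V where V: "W = V @ d" "X = P' @ V"
    using 2(1) by (auto simp: append_eq_append_conv2)
  have "w = word_inv c @ take M V @ (drop M V @ d)" using 1(2) V by (simp flip: append_assoc)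
  moreover have "word_inv g \<cdot> w \<cdot> g = P' @ take M V @ (drop M V @ S')"
    using 1(3) 2(3) V by (simp flip: append_assoc)
  moreover have "length (take M V) = M" using lenW V by simp
  moreover have "word_inv c = g \<cdot> P'"
  proof -
    have g: "g = word_inv c @ word_inv P'" using arg_cong[OF 1(1), of word_inv] by simp
    then have "g = word_inv c \<cdot> word_inv P'" using red(2) by (metis word_mult_append)
    moreover have P': "reduced P'" using red(3) 1(1) by (simp add: reduced_append)
    ultimately have "g \<cdot> P' = word_inv c \<cdot> (word_inv P' \<cdot> P')"
      by (simp add: foldr_assoc)
    also have "word_inv P' \<cdot> P' = []"
      using word_inv_mult[of "[]" P'] P' by (simp add: foldr_Nil)
    finally show ?thesis
      using g red(2) by (simp add: foldr_Nil reduced_append)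
  qed
  ultimately show thesis using that by blast
qed

theorem malnormal_H: "malnormal (free_group A) H"
proof -
  interpret group "free_group A" by (rule group_free_group)
  let ?conj = "\<lambda>g h. inv\<^bsub>free_group A\<^esub> g \<otimes>\<^bsub>free_group A\<^esub> h \<otimes>\<^bsub>free_group A\<^esub> g"
  have "x = []" if g: "g \<in> reduced_words A" "g \<notin> H" and x: "x \<in> H" and h: "h \<in> H" "x = ?conj g h"
    for g x h
  proof (rule ccontr)
    assume "x \<noteq> []"
    have hA: "h \<in> reduced_words A" using h(1) H_sub by auto
    have "h \<noteq> []" using \<open>x \<noteq> []\<close> h(2) l_inv[of g] g(1) foldr_Nil[of "word_inv g"] by (auto simp: reduced_words_def)
    then obtain N :: nat where N: "2 * length g + 4 * L \<le> length (h [^]\<^bsub>free_group A\<^esub> N)"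
      using powers_unbounded[OF hA] by blast
    let ?w = "h [^]\<^bsub>free_group A\<^esub> N"
    have "u [^]\<^bsub>free_group A\<^esub> n \<in> H" if "u \<in> H" for u and n :: nat
      using that by (induction n) (auto intro: H_mult Nil_H)
    then have w: "?w \<in> H" "x [^]\<^bsub>free_group A\<^esub> N \<in> H"
      using h(1) x by auto
    have "x [^]\<^bsub>free_group A\<^esub> N = word_inv g \<cdot> ?w \<cdot> g"
      using conjugate_pow[of "word_inv g" h N] h(2) hA g(1) by simp
    moreover obtain P B S P' S' where *: "?w = P @ B @ S" "word_inv g \<cdot> ?w \<cdot> g = P' @ B @ S'"
        "length B = 4 * L" "P = g \<cdot> P'"
      using conjugate_common_block[OF _ g(1) N] w(1) H_sub by blast
    ultimately have "g \<in> H"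
      using common_block_imp_in_H[OF _ _ *(3) g(1) *(4)] w by simp
    then show False using g(2) by simp
  qed
  moreover note Nil_H
  moreover have "[] = ?conj g []" if "g \<in> reduced_words A" for g
    using that l_inv[of g] foldr_Nil[of "word_inv g"] by (simp add: reduced_words_def)
  ultimately have "H \<inter> ?conj g ` H = {[]}" if "g \<in> reduced_words A - H" for g
    using that by (intro equalityI subsetI) (blast, simp only: Int_iff, blast)
  then show ?thesis
    unfolding malnormal_def using H_subgroup by simp
qed

end

lemma malnormal_generate:
  assumes S: "S \<subseteq> reduced_words A" and L: "0 < L"
    and "no_repeats L (S \<union> word_inv ` S)" and "\<And>h. h \<in> S \<Longrightarrow> 4 * L \<le> length h"
  shows "malnormal (free_group A) (generate (free_group A) S)"
proof -
  interpret group "free_group A" by (rule group_free_group)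
  interpret small_overlap A "S \<union> word_inv ` S" L
    by unfold_locales (use assms in auto)
  have sub: "subgroup (generate (free_group A) S) (free_group A)"
    using S by (simp add: generate_is_subgroup)
  have "S \<union> word_inv ` S \<subseteq> generate (free_group A) S"
    using S subgroup.m_inv_closed[OF sub] by (fastforce intro: generate.incl)
  then have "generate (free_group A) S = H"
    using generate_subgroup_incl[OF _ sub] mono_generate[of S "S \<union> word_inv ` S"] by blast
  then show ?thesis using malnormal_H by simp
qed

section \<open>Counting reduced words\<close>

lemma finite_reduced_words_upto [simp]:
  assumes "finite A"
  shows "finite (reduced_words_upto A n)"
proof (rule finite_subset)
  show "reduced_words_upto A n \<subseteq> {w. set w \<subseteq> A \<times> UNIV \<and> length w \<le> n}"
    by (auto simp: reduced_words_upto_def reduced_words_def)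
qed (rule finite_lists_length_le, use assms in simp)

definition reduced_words_of_length :: "'a set \<Rightarrow> nat \<Rightarrow> 'a letter list set" where
  "reduced_words_of_length A n = {w \<in> reduced_words A. length w = n}"

lemma reduced_words_of_length_subset: "reduced_words_of_length A n \<subseteq> reduced_words_upto A n"
  by (auto simp: reduced_words_of_length_def reduced_words_upto_def)

lemma finite_reduced_words_of_length [simp]: "finite A \<Longrightarrow> finite (reduced_words_of_length A n)"
  using finite_subset[OF reduced_words_of_length_subset finite_reduced_words_upto] .

lemma card_reduced_words_of_length:
  assumes "finite A" and "card A \<ge> 1"
  shows "card (reduced_words_of_length A (Suc n)) = 2 * card A * (2 * card A - 1) ^ n"
proof (induction n)
  case 0
  have "reduced_words_of_length A (Suc 0) = (\<lambda>x. [x]) ` (A \<times> (UNIV :: bool set))"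
    by (auto simp: reduced_words_of_length_def reduced_words_def length_Suc_conv)
  then show ?case
    using assms by (simp add: card_image inj_on_def card_cartesian_product)
next
  case (Suc n)
  let ?X = "\<lambda>w. A \<times> UNIV - {inv_letter (hd w)} :: 'a letter set"
  let ?S = "SIGMA w : reduced_words_of_length A (Suc n). ?X w"
  have "bij_betw (\<lambda>(w, x). x # w) ?S (reduced_words_of_length A (Suc (Suc n)))"
  proof (intro bij_betwI[where g = "\<lambda>w. (tl w, hd w)"])
    show "(\<lambda>(w, x). x # w) \<in> ?S \<rightarrow> reduced_words_of_length A (Suc (Suc n))"
      by (auto simp: reduced_words_of_length_def reduced_words_def length_Suc_conv)
    show "(\<lambda>w. (tl w, hd w)) \<in> reduced_words_of_length A (Suc (Suc n)) \<rightarrow> ?S"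
      by (auto simp: reduced_words_of_length_def reduced_words_def length_Suc_conv)
  qed (auto simp: reduced_words_of_length_def length_Suc_conv)
  then have "card (reduced_words_of_length A (Suc (Suc n))) = card ?S"
    by (simp add: bij_betw_same_card)
  also have "\<dots> = (\<Sum>w \<in> reduced_words_of_length A (Suc n). card (?X w))"
    using assms by simp
  also have "\<dots> = (\<Sum>w \<in> reduced_words_of_length A (Suc n). 2 * card A - 1)"
  proof (intro sum.cong refl)
    fix w assume "w \<in> reduced_words_of_length A (Suc n)"
    then have "inv_letter (hd w) \<in> A \<times> UNIV"
      by (auto simp: reduced_words_of_length_def reduced_words_def length_Suc_conv inv_letter_def)
    then show "card (?X w) = 2 * card A - 1"
      using assms by (simp add: card_cartesian_product mult.commute)
  qed
  finally show ?case by (simp add: Suc mult.assoc mult.commute)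
qed

lemma card_reduced_words_upto_ge:
  assumes "finite A" and "card A \<ge> 1"
  shows "(2 * card A - 1) ^ n \<le> card (reduced_words_upto A n)"
proof -
  have "(2 * card A - 1) ^ n \<le> card (reduced_words_of_length A n)"
  proof (cases n)
    case 0
    then have "reduced_words_of_length A n = {[]}"
      by (auto simp: reduced_words_of_length_def reduced_words_def)
    with 0 show ?thesis by simp
  next
    case (Suc m)
    then show ?thesis
      using card_reduced_words_of_length[OF assms, of m] by (simp add: mult_le_mono1)
  qed
  also have "\<dots> \<le> card (reduced_words_upto A n)"
    using assms by (intro card_mono reduced_words_of_length_subset) simp
  finally show ?thesis .
qed

lemma card_reduced_words_upto_le:
  assumes "finite A" and "card A \<ge> 2"
  shows "card (reduced_words_upto A n) \<le> 3 * (2 * card A - 1) ^ n"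
proof (induction n)
  case 0
  have "reduced_words_upto A 0 = {[]}"
    by (auto simp: reduced_words_upto_def reduced_words_def)
  then show ?case by simp
next
  case (Suc n)
  let ?q = "2 * card A - 1"
  have "reduced_words_upto A (Suc n) = reduced_words_upto A n \<union> reduced_words_of_length A (Suc n)"
    by (auto simp: reduced_words_upto_def reduced_words_of_length_def)
  then have "card (reduced_words_upto A (Suc n)) \<le>
      card (reduced_words_upto A n) + card (reduced_words_of_length A (Suc n))"
    by (simp add: card_Un_le)
  also have "\<dots> \<le> 3 * ?q ^ n + 2 * card A * ?q ^ n"
    using Suc card_reduced_words_of_length[of A n] assms by simp
  also have "\<dots> = (3 + 2 * card A) * ?q ^ n" by (simp add: algebra_simps)
  also have "\<dots> \<le> (3 * ?q) * ?q ^ n"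
    using assms by (intro mult_le_mono1) linarith
  finally show ?case by simp
qed

text \<open>A stretch of \<open>l\<close> letters without any freedom of choice. As \<open>F\<close> sees the position and the whole
  prefix, it can copy or mirror an earlier block of the same word, or copy a fixed word.\<close>
definition predicted ::
  "'a set \<Rightarrow> nat \<Rightarrow> nat \<Rightarrow> nat \<Rightarrow> (nat \<Rightarrow> 'a letter list \<Rightarrow> 'a letter) \<Rightarrow> 'a letter list set" where
  "predicted A n l a F =
     {w \<in> reduced_words_upto A n. a + l \<le> length w \<and> (\<forall>s. a \<le> s \<longrightarrow> s < a + l \<longrightarrow> w ! s = F s (take s w))}"

text \<open>Such a word is determined by what precedes and what follows its \<open>l\<close> predicted letters, that is,
  by two reduced words of total length at most \<open>n - l\<close>. The constant 9 is the square of the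
  constant 3 in \<open>card_reduced_words_upto_le\<close>.\<close>
lemma card_predicted:
  assumes "finite A" and "card A \<ge> 2"
  shows "card (predicted A n l a F) * (2 * card A - 1) ^ l \<le> 9 * (2 * card A - 1) ^ n"
proof (cases "a + l \<le> n")
  case True
  let ?q = "2 * card A - 1"
  let ?f = "\<lambda>w. (take a w, drop (a + l) w)"
  have inj: "inj_on ?f (predicted A n l a F)"
  proof (rule inj_onI)
    fix v w assume v: "v \<in> predicted A n l a F" and w: "w \<in> predicted A n l a F"
      and eq: "?f v = ?f w"
    have "take (a + i) v = take (a + i) w" if "i \<le> l" for i
      using that
    proof (induction i)
      case (Suc i)
      then have "take (a + i) v = take (a + i) w" "a + i < length v" "a + i < length w"
        using v w by (auto simp: predicted_def)
      moreover from this have "v ! (a + i) = w ! (a + i)"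
        using v w Suc.prems by (simp add: predicted_def)
      ultimately show ?case by (simp add: take_Suc_conv_app_nth)
    qed (use eq in simp)
    then show "v = w" using eq append_take_drop_id[of "a + l"] by (metis order_refl prod.inject)
  qed
  have "?f ` predicted A n l a F \<subseteq> reduced_words_upto A a \<times> reduced_words_upto A (n - (a + l))"
  proof (clarify, rule conjI)
    fix w assume "w \<in> predicted A n l a F"
    then have w: "w \<in> reduced_words A" "length w \<le> n"
      by (auto simp: predicted_def reduced_words_upto_def)
    have "take a w \<in> reduced_words A" "drop (a + l) w \<in> reduced_words A"
      using w reduced_words_append_iff[of "take a w" "drop a w"]
        reduced_words_append_iff[of "take (a + l) w" "drop (a + l) w"] by auto
    then show "take a w \<in> reduced_words_upto A a"
      and "drop (a + l) w \<in> reduced_words_upto A (n - (a + l))"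
      using w by (auto simp: reduced_words_upto_def)
  qed
  then have "card (predicted A n l a F) \<le>
      card (reduced_words_upto A a \<times> reduced_words_upto A (n - (a + l)))"
    using assms inj by (intro card_inj_on_le[where f = ?f]) auto
  also have "\<dots> \<le> (3 * ?q ^ a) * (3 * ?q ^ (n - (a + l)))"
    using assms by (simp only: card_cartesian_product) (intro mult_le_mono card_reduced_words_upto_le)
  finally have "card (predicted A n l a F) * ?q ^ l \<le> (3 * ?q ^ a) * (3 * ?q ^ (n - (a + l))) * ?q ^ l"
    by (rule mult_le_mono1)
  also have "\<dots> = 9 * (?q ^ a * ?q ^ (n - (a + l)) * ?q ^ l)" by simp
  also have "?q ^ a * ?q ^ (n - (a + l)) * ?q ^ l = ?q ^ n"
    using True by (simp flip: power_add)
  finally show ?thesis .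
next
  case False
  then have "predicted A n l a F = {}" by (auto simp: predicted_def reduced_words_upto_def)
  then show ?thesis by simp
qed

lemma finite_predicted [simp]: "finite A \<Longrightarrow> finite (predicted A n l a F)"
  by (rule finite_subset[OF _ finite_reduced_words_upto]) (auto simp: predicted_def)

section \<open>Random tuples rarely repeat a block\<close>

abbreviation delete_nth :: "nat \<Rightarrow> 'b list \<Rightarrow> 'b list" where
  "delete_nth i xs \<equiv> take i xs @ drop (Suc i) xs"

text \<open>Conditioning on the other coordinates: a condition on one coordinate that holds for at most \<open>b\<close>
  values, whatever the others are, holds for a proportion of at most \<open>b / card R\<close> of the tuples.\<close>
lemma card_tuples_coordinate:
  assumes "finite R" and "i < k"
    and "\<And>ts. length ts = k - 1 \<Longrightarrow> set ts \<subseteq> R \<Longrightarrow> finite (B ts) \<and> card (B ts) \<le> b"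
  shows "card {xs. length xs = k \<and> set xs \<subseteq> R \<and> xs ! i \<in> B (delete_nth i xs)} \<le> card R ^ (k - 1) * b"
    (is "card ?T \<le> _")
proof -
  let ?L = "{ts. set ts \<subseteq> R \<and> length ts = k - 1}"
  have fin: "finite ?L" using assms(1) by (rule finite_lists_length_eq)
  let ?g = "\<lambda>ts x. take i ts @ x # drop i ts"
  have "?T \<subseteq> (\<Union>ts\<in>?L. ?g ts ` B ts)"
  proof
    fix xs assume xs: "xs \<in> ?T"
    have "xs = ?g (delete_nth i xs) (xs ! i)"
      using xs assms(2) by (simp add: id_take_nth_drop[symmetric])
    moreover have "delete_nth i xs \<in> ?L"
      using xs assms(2) by (auto dest: in_set_takeD in_set_dropD)
    ultimately show "xs \<in> (\<Union>ts\<in>?L. ?g ts ` B ts)" using xs by blast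
  qed
  then have "card ?T \<le> card (\<Union>ts\<in>?L. ?g ts ` B ts)"
    using fin assms(3) by (intro card_mono finite_UN_I finite_imageI) auto
  also have "\<dots> \<le> (\<Sum>ts\<in>?L. card (?g ts ` B ts))"
    using fin by (rule card_UN_le)
  also have "\<dots> \<le> (\<Sum>ts\<in>?L. b)"
    using assms(3) by (intro sum_mono) (blast intro: card_image_le le_trans)
  also have "\<dots> = card R ^ (k - 1) * b"
    using card_lists_length_eq[OF assms(1)] by simp
  finally show ?thesis .
qed

text \<open>The three kinds of predictors stand for a block that repeats an earlier block of the same word,
  mirrors an earlier block of the same word, or repeats a block of one of the other words \<open>ts\<close> or
  of its inverse. The position \<open>p\<close> is where the block is copied from; since only an upper bound on
  the size matters, all pairs \<open>(a, p)\<close> are admitted, even those where the predictor reads outside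
  of a list and returns an unspecified letter.\<close>
definition repetition_set ::
  "'a set \<Rightarrow> nat \<Rightarrow> nat \<Rightarrow> 'a letter list list \<Rightarrow> 'a letter list set" where
  "repetition_set A n l ts =
     (\<Union>(a, p) \<in> {0..n} \<times> {0..n}.
        predicted A n l a (\<lambda>s w. w ! (p + (s - a))) \<union>
        predicted A n l a (\<lambda>s w. inv_letter (w ! (p - (s - a)))) \<union>
        (\<Union>v \<in> set ts \<union> word_inv ` set ts. predicted A n l a (\<lambda>s w. v ! (p + (s - a)))))"

lemma card_repetition_set:
  assumes "finite A" and "card A \<ge> 2"
  shows "card (repetition_set A n l ts) * (2 * card A - 1) ^ l
           \<le> (n + 1)\<^sup>2 * (2 + 2 * length ts) * (9 * (2 * card A - 1) ^ n)"
proof -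
  let ?q = "2 * card A - 1"
  let ?V = "set ts \<union> word_inv ` set ts"
  let ?P = "\<lambda>a p v. predicted A n l a (\<lambda>s w. v ! (p + (s - a)))"
  let ?D = "\<lambda>a p. predicted A n l a (\<lambda>s w. w ! (p + (s - a))) \<union>
        predicted A n l a (\<lambda>s w. inv_letter (w ! (p - (s - a)))) \<union> (\<Union>v \<in> ?V. ?P a p v)"
  have V: "card ?V \<le> 2 * length ts"
  proof -
    have "card ?V \<le> card (set ts) + card (word_inv ` set ts)" by (rule card_Un_le)
    also have "\<dots> \<le> card (set ts) + card (set ts)" by (simp add: card_image_le)
    also have "\<dots> \<le> 2 * length ts" using card_length[of ts] by simp
    finally show ?thesis .
  qed
  have D: "card (?D a p) * ?q ^ l \<le> (2 + 2 * length ts) * (9 * ?q ^ n)" for a p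
  proof -
    have "card (\<Union>v \<in> ?V. ?P a p v) * ?q ^ l \<le> (\<Sum>v\<in>?V. card (?P a p v)) * ?q ^ l"
      by (intro mult_le_mono1 card_UN_le) simp
    also have "\<dots> = (\<Sum>v\<in>?V. card (?P a p v) * ?q ^ l)" by (simp add: sum_distrib_right)
    also have "\<dots> \<le> (\<Sum>v\<in>?V. 9 * ?q ^ n)" using assms by (intro sum_mono card_predicted)
    also have "\<dots> = card ?V * (9 * ?q ^ n)" by simp
    also have "\<dots> \<le> 2 * length ts * (9 * ?q ^ n)" using V by (rule mult_le_mono1)
    finally have 1: "card (\<Union>v \<in> ?V. ?P a p v) * ?q ^ l \<le> 2 * length ts * (9 * ?q ^ n)" .
    have "card (?D a p) \<le> card (predicted A n l a (\<lambda>s w. w ! (p + (s - a)))) +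
        card (predicted A n l a (\<lambda>s w. inv_letter (w ! (p - (s - a))))) + card (\<Union>v \<in> ?V. ?P a p v)"
      by (meson add_le_mono card_Un_le le_refl le_trans)
    then have "card (?D a p) * ?q ^ l \<le> card (predicted A n l a (\<lambda>s w. w ! (p + (s - a)))) * ?q ^ l +
        card (predicted A n l a (\<lambda>s w. inv_letter (w ! (p - (s - a))))) * ?q ^ l +
        card (\<Union>v \<in> ?V. ?P a p v) * ?q ^ l"
      by (metis add_mult_distrib mult_le_mono1)
    also have "\<dots> \<le> 9 * ?q ^ n + 9 * ?q ^ n + 2 * length ts * (9 * ?q ^ n)"
      using assms 1 by (intro add_le_mono card_predicted)
    finally show ?thesis by (simp add: algebra_simps)
  qed
  have "card (repetition_set A n l ts) * ?q ^ l \<le> (\<Sum>(a, p) \<in> {0..n} \<times> {0..n}. card (?D a p)) * ?q ^ l"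
    unfolding repetition_set_def case_prod_unfold by (intro mult_le_mono1 card_UN_le) simp
  also have "\<dots> = (\<Sum>(a, p) \<in> {0..n} \<times> {0..n}. card (?D a p) * ?q ^ l)"
    by (simp only: sum_distrib_right case_prod_unfold)
  also have "\<dots> \<le> (\<Sum>(a, p) \<in> {0..n} \<times> {0..n}. (2 + 2 * length ts) * (9 * ?q ^ n))"
    unfolding case_prod_unfold by (intro sum_mono D)
  also have "\<dots> = (n + 1)\<^sup>2 * (2 + 2 * length ts) * (9 * ?q ^ n)"
    by (simp add: card_cartesian_product power2_eq_square case_prod_unfold algebra_simps)
  finally show ?thesis .
qed

lemma nth_append_block:
  "i < length C \<Longrightarrow> (u @ C @ v) ! (length u + i) = C ! i"
  by (simp add: nth_append)

lemma predictedI: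
  assumes "w \<in> reduced_words_upto A n" and "a + l \<le> length w"
    and "\<And>t. t < l \<Longrightarrow> w ! (a + t) = F (a + t) (take (a + t) w)"
  shows "w \<in> predicted A n l a F"
proof -
  have "w ! s = F s (take s w)" if "a \<le> s" "s < a + l" for s
    using assms(3)[of "s - a"] that by simp
  then show ?thesis using assms(1,2) by (simp add: predicted_def)
qed

text \<open>The two occurrences may overlap: each letter of the later one is still a copy of a letter strictly
  to its left.\<close>
lemma shifted_block_predicted:
  assumes "w \<in> reduced_words_upto A n" and "w = u1 @ C @ u2" and "w = v1 @ C @ v2"
    and "length u1 < length v1" and "l \<le> length C"
  shows "w \<in> predicted A n l (length v1) (\<lambda>s w. w ! (length u1 + (s - length v1)))"
proof (rule predictedI)
  fix t assume t: "t < l"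
  have "w ! (length v1 + t) = C ! t"
    using nth_append_block[of t C v1 v2] t assms(3,5) by simp
  also have "\<dots> = w ! (length u1 + t)"
    using nth_append_block[of t C u1 u2] t assms(2,5) by simp
  also have "\<dots> = take (length v1 + t) w ! (length u1 + (length v1 + t - length v1))"
    using assms(4) by simp
  finally show "w ! (length v1 + t) = take (length v1 + t) w ! (length u1 + (length v1 + t - length v1))" .
next
  show "length v1 + l \<le> length w" using assms(5) by (subst assms(3)) simp
qed (fact assms(1))

text \<open>If \<open>C\<close> and \<open>word_inv C\<close> overlap, letters of the later occurrence may be mirror images of
  letters to their right. In its second half this cannot happen, as the centre of the reflection
  lies at or before the middle of that occurrence; so only \<open>l\<close> of the \<open>2 * l\<close> letters are used.\<close>
lemma mirrored_block_predicted:
  assumes "w \<in> reduced_words_upto A n" and "w = u1 @ C @ u2" and "w = v1 @ word_inv C @ v2"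
    and "length u1 \<le> length v1" and "length C = 2 * l" and "0 < l"
  shows "w \<in> predicted A n l (length v1 + l)
               (\<lambda>s w. inv_letter (w ! (length u1 + l - 1 - (s - (length v1 + l)))))"
proof (rule predictedI)
  fix t assume t: "t < l"
  have "w ! (length v1 + l + t) = word_inv C ! (l + t)"
    using nth_append_block[of "l + t" "word_inv C" v1 v2] t assms(3,5) by (simp add: add.assoc)
  also have "\<dots> = inv_letter (C ! (l - 1 - t))"
    using t assms(5) by (simp add: nth_word_inv)
  also have "C ! (l - 1 - t) = w ! (length u1 + (l - 1 - t))"
    using nth_append_block[of "l - 1 - t" C u1 u2] t assms(2,5) by simp
  also have "length u1 + (l - 1 - t) = length u1 + l - 1 - (length v1 + l + t - (length v1 + l))"
    using t by simp
  also have "w ! \<dots> = take (length v1 + l + t) w ! \<dots>"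
    using assms(4) t by simp
  finally show "w ! (length v1 + l + t) = inv_letter (take (length v1 + l + t) w !
      (length u1 + l - 1 - (length v1 + l + t - (length v1 + l))))" .
next
  show "length v1 + l + l \<le> length w" using assms(5) by (subst assms(3)) simp
qed (fact assms(1))

lemma repetition_setI:
  assumes "a \<le> n" and "p \<le> n"
  shows "w \<in> predicted A n l a (\<lambda>s w. w ! (p + (s - a))) \<Longrightarrow> w \<in> repetition_set A n l ts"
    and "w \<in> predicted A n l a (\<lambda>s w. inv_letter (w ! (p - (s - a)))) \<Longrightarrow> w \<in> repetition_set A n l ts"
    and "w \<in> predicted A n l a (\<lambda>s w. v ! (p + (s - a))) \<Longrightarrow> v \<in> set ts \<union> word_inv ` set ts
           \<Longrightarrow> w \<in> repetition_set A n l ts"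
proof -
  let ?V = "set ts \<union> word_inv ` set ts"
  have sub: "predicted A n l a (\<lambda>s w. w ! (p + (s - a))) \<union>
        predicted A n l a (\<lambda>s w. inv_letter (w ! (p - (s - a)))) \<union>
        (\<Union>v \<in> ?V. predicted A n l a (\<lambda>s w. v ! (p + (s - a)))) \<subseteq> repetition_set A n l ts"
    unfolding repetition_set_def by (rule order_trans[OF _ UN_upper[of "(a, p)"]]) (use assms in auto)
  show "w \<in> predicted A n l a (\<lambda>s w. w ! (p + (s - a))) \<Longrightarrow> w \<in> repetition_set A n l ts"
    and "w \<in> predicted A n l a (\<lambda>s w. inv_letter (w ! (p - (s - a)))) \<Longrightarrow> w \<in> repetition_set A n l ts"
    and "w \<in> predicted A n l a (\<lambda>s w. v ! (p + (s - a))) \<Longrightarrow> v \<in> ?V \<Longrightarrow> w \<in> repetition_set A n l ts"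
    using sub by blast+
qed

text \<open>If \<open>y\<close> comes from another entry, all of the block is copied from there. If \<open>y\<close> is the entry
  itself, one of the two occurrences is strictly later, since equal positions would make the two
  factorizations equal. If \<open>y\<close> is the inverse of the entry, then the entry reads \<open>C\<close> and
  \<open>word_inv C\<close>, and the later of the two is mirrored.\<close>
lemma block_in_repetition_set:
  assumes hs: "set hs \<subseteq> reduced_words_upto A n" and i: "i < length hs" and j: "j < length hs"
    and x: "hs ! i = u1 @ C @ u2" and y: "y = v1 @ C @ v2" "y = hs ! j \<or> y = word_inv (hs ! j)"
    and C: "length C = 2 * l" "0 < l" and neq: "\<not> (u1 = v1 \<and> u2 = v2)"
  shows "hs ! i \<in> repetition_set A n l (delete_nth i hs)"
proof -
  have R: "hs ! i \<in> reduced_words_upto A n" "hs ! j \<in> reduced_words_upto A n"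
    using hs i j by auto
  then have len: "length (hs ! i) \<le> n" "length y \<le> n"
    using y(2) by (auto simp: reduced_words_upto_def)
  consider "j \<noteq> i" | "y = hs ! i" | "y = word_inv (hs ! i)" using y(2) by blast
  then show ?thesis
  proof cases
    case 1
    have "hs ! j \<in> set (delete_nth i hs)"
    proof (cases "j < i")
      case True
      then show ?thesis using i by (auto simp: in_set_conv_nth intro!: exI[of _ j])
    next
      case False
      with 1 j have "drop (Suc i) hs ! (j - Suc i) = hs ! j" "j - Suc i < length (drop (Suc i) hs)"
        by auto
      then show ?thesis by (metis Un_iff nth_mem set_append)
    qed
    then have v: "y \<in> set (delete_nth i hs) \<union> word_inv ` set (delete_nth i hs)"
      using y(2) by blast
    have "hs ! i \<in> predicted A n l (length u1) (\<lambda>s w. y ! (length v1 + (s - length u1)))"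
    proof (rule predictedI)
      fix t assume t: "t < l"
      show "hs ! i ! (length u1 + t) = y ! (length v1 + (length u1 + t - length u1))"
        using nth_append_block[of t C u1 u2] nth_append_block[of t C v1 v2] t C x y(1) by simp
    qed (use R x C in auto)
    then show ?thesis
      using len x y(1) by (intro repetition_setI(3)[OF _ _ _ v, of "length u1" n "length v1"]) simp_all
  next
    case 2
    then have eq: "u1 @ C @ u2 = v1 @ C @ v2" using x y(1) by simp
    then have "length u1 \<noteq> length v1" using neq by auto
    then consider "length u1 < length v1" | "length v1 < length u1" by linarith
    then show ?thesis
    proof cases
      case a: 1
      have "hs ! i \<in> predicted A n l (length v1) (\<lambda>s w. w ! (length u1 + (s - length v1)))"
        using shifted_block_predicted[OF R(1) x _ a, of v2 l] eq x C by simp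
      then show ?thesis
        using x y(1) len by (intro repetition_setI(1)[of "length v1" n "length u1"]) simp_all
    next
      case a: 2
      have "hs ! i \<in> predicted A n l (length u1) (\<lambda>s w. w ! (length v1 + (s - length u1)))"
        using shifted_block_predicted[OF R(1) _ x a, of v2 l] eq x C by simp
      then show ?thesis
        using x y(1) len by (intro repetition_setI(1)[of "length u1" n "length v1"]) simp_all
    qed
  next
    case 3
    then have "hs ! i = word_inv y" by simp
    then have x': "hs ! i = word_inv v2 @ word_inv C @ word_inv v1"
      unfolding y(1) by (metis append.assoc word_inv_append word_inv_word_inv)
    have lens: "length u1 + 2 * l \<le> n" "length (word_inv v2) + 2 * l \<le> n"
      using len(1) x C(1) arg_cong[OF x', of length] by auto
    consider "length u1 \<le> length (word_inv v2)" | "length (word_inv v2) \<le> length u1" by linarith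
    then show ?thesis
    proof cases
      case a: 1
      show ?thesis
        using mirrored_block_predicted[OF R(1) x x' a C] lens
        by (intro repetition_setI(2)[of "length (word_inv v2) + l" n "length u1 + l - 1"]) auto
    next
      case a: 2
      have x2: "hs ! i = u1 @ word_inv (word_inv C) @ u2" using x by simp
      show ?thesis
        using mirrored_block_predicted[OF R(1) x' x2 a _ C(2)] lens C(1)
        by (intro repetition_setI(2)[of "length u1 + l" n "length (word_inv v2) + l - 1"]) auto
    qed
  qed
qed

text \<open>Replacing both words by their inverses, the first occurrence of the repeated block can be taken in
  an entry of the tuple rather than in the inverse of an entry.\<close>
lemma repeats_imp_repetition_set:
  assumes hs: "set hs \<subseteq> reduced_words_upto A n" and l: "0 < l"
    and "\<not> no_repeats (2 * l) (set hs \<union> word_inv ` set hs)"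
  shows "\<exists>i<length hs. hs ! i \<in> repetition_set A n l (delete_nth i hs)"
proof -
  let ?Y = "set hs \<union> word_inv ` set hs"
  have main: "\<exists>i<length hs. hs ! i \<in> repetition_set A n l (delete_nth i hs)"
    if in_hs: "p @ C @ s \<in> set hs" and in_Y: "p' @ C @ s' \<in> ?Y" and len: "length C = 2 * l"
      and neq: "\<not> (p = p' \<and> s = s')"
    for p C s p' s'
  proof -
    obtain i where i: "i < length hs" "hs ! i = p @ C @ s"
      using in_hs by (auto simp: in_set_conv_nth)
    obtain h where "h \<in> set hs" and h: "p' @ C @ s' = h \<or> p' @ C @ s' = word_inv h"
      using in_Y by blast
    then obtain j where "j < length hs" "hs ! j = h" by (auto simp: in_set_conv_nth)
    then show ?thesis
      using block_in_repetition_set[OF hs i(1) _ i(2) refl _ len l neq] i(1) h by blast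
  qed
  obtain p C s p' s' where *: "p @ C @ s \<in> ?Y" "p' @ C @ s' \<in> ?Y" "length C = 2 * l"
      "\<not> (p = p' \<and> s = s')"
    using assms(3) unfolding no_repeats_def by blast
  show ?thesis
  proof (cases "p @ C @ s \<in> set hs")
    case True
    then show ?thesis using main * by blast
  next
    case False
    have inv: "word_inv y \<in> ?Y" if "y \<in> ?Y" for y using that by auto
    obtain h where "h \<in> set hs" "p @ C @ s = word_inv h" using False *(1) by auto
    then have "word_inv (p @ C @ s) \<in> set hs" by (simp only: word_inv_word_inv)
    then have "word_inv s @ word_inv C @ word_inv p \<in> set hs" by simp
    moreover have "word_inv s' @ word_inv C @ word_inv p' \<in> ?Y" using inv[OF *(2)] by simp
    ultimately show ?thesis by (rule main) (use *(3,4) in auto)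
  qed
qed

section \<open>Malnormality is exponentially generic\<close>

text \<open>The criterion is applied with blocks of length \<open>L = 2 * l\<close>, so that entries of length at least
  \<open>4 * L = 8 * l\<close> are long enough. With \<open>9 * l \<le> n\<close>, the shorter ones are at most a proportion
  of order \<open>q\<close> to the power \<open>-l\<close>, as are the words with a repeated block at given places. The constant
  21 is 3, from the short entries, plus \<open>2 * 9\<close>, from the \<open>2 * k\<close> kinds of repetition.\<close>
lemma card_not_malnormal:
  fixes A :: "'a set" and k n :: nat
  defines "R \<equiv> reduced_words_upto A n" and "l \<equiv> n div 16"
  assumes A: "finite A" "card A \<ge> 2" and "k \<ge> 1" and "n \<ge> 16"
  shows "card {hs. length hs = k \<and> set hs \<subseteq> R \<and>
             \<not> malnormal (free_group A) (generate (free_group A) (set hs))} * (2 * card A - 1) ^ l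
           \<le> 21 * k\<^sup>2 * (n + 1)\<^sup>2 * card R ^ k" (is "card ?Bad * _ \<le> _")
proof -
  let ?q = "2 * card A - 1"
  define B where "B ts = reduced_words_upto A (8 * l) \<union> repetition_set A n l ts" for ts
  define b where "b = 21 * k * (n + 1)\<^sup>2 * ?q ^ n div ?q ^ l"
  let ?T = "\<lambda>i. {hs. length hs = k \<and> set hs \<subseteq> R \<and> hs ! i \<in> B (delete_nth i hs)}"
  have q: "1 \<le> ?q" using A by simp
  have l: "0 < l" "9 * l \<le> n" using \<open>n \<ge> 16\<close> by (auto simp: l_def)
  have finR: "finite R" using A by (simp add: R_def)
  have finB: "finite (B ts)" for ts
    using A by (auto simp: B_def repetition_set_def)
  have B: "card (B ts) \<le> b" if "length ts = k - 1" for ts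
  proof -
    have "card (reduced_words_upto A (8 * l)) * ?q ^ l \<le> (3 * ?q ^ (8 * l)) * ?q ^ l"
      using card_reduced_words_upto_le[OF A] by (rule mult_le_mono1)
    also have "\<dots> = 3 * ?q ^ (9 * l)" by (simp flip: power_add)
    also have "\<dots> \<le> 3 * ?q ^ n" using q l(2) by (intro mult_le_mono2 power_increasing)
    finally have short: "card (reduced_words_upto A (8 * l)) * ?q ^ l \<le> 3 * ?q ^ n" .
    have "card (B ts) * ?q ^ l \<le>
        card (reduced_words_upto A (8 * l)) * ?q ^ l + card (repetition_set A n l ts) * ?q ^ l"
      unfolding B_def by (metis add_mult_distrib card_Un_le mult_le_mono1)
    also have "\<dots> \<le> 3 * ?q ^ n + (n + 1)\<^sup>2 * (2 + 2 * length ts) * (9 * ?q ^ n)"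
      using short card_repetition_set[OF A] by (rule add_le_mono)
    also have "2 + 2 * length ts = 2 * k" using that \<open>k \<ge> 1\<close> by simp
    also have "3 * ?q ^ n + (n + 1)\<^sup>2 * (2 * k) * (9 * ?q ^ n) = (3 * 1 + 18 * (k * (n + 1)\<^sup>2)) * ?q ^ n"
      by (simp add: algebra_simps)
    also have "\<dots> \<le> (3 * (k * (n + 1)\<^sup>2) + 18 * (k * (n + 1)\<^sup>2)) * ?q ^ n"
      using \<open>k \<ge> 1\<close> by (intro mult_le_mono1 add_le_mono mult_le_mono2) auto
    finally have "card (B ts) * ?q ^ l \<le> 21 * k * (n + 1)\<^sup>2 * ?q ^ n" by (simp add: mult.assoc)
    moreover have "0 < ?q ^ l" using A by simp
    ultimately show ?thesis unfolding b_def by (simp only: less_eq_div_iff_mult_less_eq)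
  qed
  have "?Bad \<subseteq> (\<Union>i<k. ?T i)"
  proof
    fix hs assume "hs \<in> ?Bad"
    then have hs: "length hs = k" "set hs \<subseteq> R"
      and bad: "\<not> malnormal (free_group A) (generate (free_group A) (set hs))" by auto
    have "\<exists>i<k. hs ! i \<in> B (delete_nth i hs)"
    proof (cases "no_repeats (2 * l) (set hs \<union> word_inv ` set hs)")
      case True
      have sub: "set hs \<subseteq> reduced_words A" using hs(2) by (auto simp: R_def reduced_words_upto_def)
      obtain h where h: "h \<in> set hs" "length h < 4 * (2 * l)"
        using malnormal_generate[OF sub _ True] bad l(1) by (metis mult_pos_pos not_le_imp_less pos2)
      then have "h \<in> reduced_words_upto A (8 * l)"
        using sub by (auto simp: reduced_words_upto_def)
      moreover obtain i where "i < k" "hs ! i = h" using h(1) hs(1) by (auto simp: in_set_conv_nth)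
      ultimately show ?thesis by (auto simp: B_def)
    next
      case False
      then show ?thesis
        using repeats_imp_repetition_set[of hs A n l] hs l(1) unfolding B_def R_def by blast
    qed
    then show "hs \<in> (\<Union>i<k. ?T i)" using hs by blast
  qed
  moreover have "finite (?T i)" for i
    by (rule finite_subset[OF _ finite_lists_length_eq[OF finR, of k]]) auto
  ultimately have "card ?Bad \<le> card (\<Union>i<k. ?T i)"
    by (intro card_mono finite_UN_I) auto
  also have "\<dots> \<le> (\<Sum>i<k. card (?T i))" by (rule card_UN_le) simp
  also have "\<dots> \<le> (\<Sum>i<k. card R ^ (k - 1) * b)"
    using B finB by (intro sum_mono card_tuples_coordinate[OF finR]) auto
  also have "\<dots> = k * (card R ^ (k - 1) * b)" by simp
  finally have "card ?Bad * ?q ^ l \<le> k * (card R ^ (k - 1) * b) * ?q ^ l"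
    by (rule mult_le_mono1)
  also have "\<dots> = k * card R ^ (k - 1) * (b * ?q ^ l)" by (simp add: mult_ac)
  also have "\<dots> \<le> k * card R ^ (k - 1) * (21 * k * (n + 1)\<^sup>2 * ?q ^ n)"
    unfolding b_def by (intro mult_le_mono2 div_times_less_eq_dividend)
  also have "\<dots> \<le> k * card R ^ (k - 1) * (21 * k * (n + 1)\<^sup>2 * card R)"
    unfolding R_def using card_reduced_words_upto_ge[of A n] A by (intro mult_le_mono2) simp
  also have "\<dots> = 21 * k\<^sup>2 * (n + 1)\<^sup>2 * (card R * card R ^ (k - 1))"
    by (simp add: power2_eq_square mult_ac)
  also have "card R * card R ^ (k - 1) = card R ^ k"
    using \<open>k \<ge> 1\<close> by (cases k) auto
  finally show ?thesis .
qed

theorem theorem4p3: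
  fixes A :: "'a set" and r k :: nat
  assumes "finite A" and "card A = r" and "r \<ge> 2" and "k \<ge> 1"
  shows "\<exists>c>0. (\<lambda>n. real (card {hs. length hs = k \<and> set hs \<subseteq> reduced_words_upto A n \<and>
                        \<not> malnormal (free_group A) (generate (free_group A) (set hs))})
                  / real (card (reduced_words_upto A n)) ^ k)
              \<in> O(\<lambda>n. exp (- c * real n))"
proof -
  let ?bad = "\<lambda>n. card {hs. length hs = k \<and> set hs \<subseteq> reduced_words_upto A n \<and>
                    \<not> malnormal (free_group A) (generate (free_group A) (set hs))}"
  let ?R = "\<lambda>n. card (reduced_words_upto A n)"
  define K where "K = 21 * real (k\<^sup>2) * exp 1"
  have bound: "real (?bad n) / real (?R n) ^ k \<le> K * ((real n + 1)\<^sup>2 * exp (- real n / 16))"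
    if n: "n \<ge> 16" for n
  proof -
    let ?q = "2 * card A - 1" and ?l = "n div 16"
    have "0 < ?q ^ n" using assms by simp
    then have R: "0 < ?R n" using card_reduced_words_upto_ge[of A n] assms by linarith
    have "real n / 16 - 1 \<le> real ?l" by linarith
    then have "exp (real n / 16 - 1) \<le> exp (real ?l)" by simp
    also have "\<dots> = exp 1 ^ ?l" by (simp flip: exp_of_nat_mult)
    also have "\<dots> \<le> 3 ^ ?l" by (intro power_mono exp_le) simp
    also have "\<dots> \<le> real ?q ^ ?l" using assms by (intro power_mono) auto
    finally have q: "exp (real n / 16 - 1) \<le> real ?q ^ ?l" .
    have "real (?bad n) * exp (real n / 16 - 1) \<le> real (?bad n) * real ?q ^ ?l"
      using q by (intro mult_left_mono) auto
    also have "\<dots> = real (?bad n * ?q ^ ?l)" by (simp only: of_nat_mult of_nat_power)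
    also have "\<dots> \<le> real (21 * k\<^sup>2 * (n + 1)\<^sup>2 * ?R n ^ k)"
      using card_not_malnormal[of A k n] assms n by (subst of_nat_le_iff) simp
    also have "\<dots> = 21 * real (k\<^sup>2) * (real n + 1)\<^sup>2 * real (?R n) ^ k" by (simp add: algebra_simps)
    finally have "real (?bad n) / real (?R n) ^ k \<le> 21 * real (k\<^sup>2) * (real n + 1)\<^sup>2 / exp (real n / 16 - 1)"
      using R by (simp add: field_simps)
    also have "\<dots> = 21 * real (k\<^sup>2) * (real n + 1)\<^sup>2 * inverse (exp (real n / 16 - 1))"
      by (rule divide_inverse)
    also have "inverse (exp (real n / 16 - 1)) = exp 1 * exp (- real n / 16)"
      by (simp flip: exp_add exp_minus)
    also have "21 * real (k\<^sup>2) * (real n + 1)\<^sup>2 * (exp 1 * exp (- real n / 16)) =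
        K * ((real n + 1)\<^sup>2 * exp (- real n / 16))"
      by (simp only: K_def mult_ac)
    finally show ?thesis .
  qed
  have "(\<lambda>n. real (?bad n) / real (?R n) ^ k) \<in> O(\<lambda>n. (real n + 1)\<^sup>2 * exp (- real n / 16))"
    by (intro bigoI[where c = K] eventually_mono[OF eventually_ge_at_top[of 16]]) (use bound in simp)
  also have "(\<lambda>n. (real n + 1)\<^sup>2 * exp (- real n / 16)) \<in> O(\<lambda>n. exp (- (1/32) * real n))"
    by real_asymp
  \<comment> \<open>Half of the rate \<open>1/16\<close> is given away to absorb the quadratic factor.\<close>
  finally show ?thesis by (intro exI[of _ "1/32"]) simp
qed

end
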